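(* Let $H$ be a limit sparse semigroup of genus $g$ with odd Frobenius number $\ell_g=2g-(2r+1)=6r+1$, where $r\in\mathbb{N}$. If the multiplicity $n_1$ of $H$ is odd, then $H$ is one of the following: (1) $H=3\mathbb{N}+H_{6r+1}$; (2) $H=\langle 2j+1 : j\in\mathbb{N},\ r\le j\le 2r-1\rangle\cup H_{6r+1}$, with $r>1$.
   Context: $\mathbb{N}$ is the set of natural numbers including $0$. A numerical semigroup $H\subseteq\mathbb{N}$ of genus $g\ge 1$ is a subset containing $0$, closed under addition, whose complement $\mathbb{N}\setminus H=\{1=\ell_1<\ell_2<\dots<\ell_g\}$ has exactly $g$ elements, called gaps; $\ell_g$ is the Frobenius number, and the smallest positive element of $H$ is the multiplicity. $H$ is sparse if $\ell_i-\ell_{i-1}\le 2$ for all $i=2,\dots,g$. A sparse semigroup is a limit sparse semigroup if the number of indices $i\in\{1,\dots,g-1\}$ with $\ell_{i+1}-\ell_i=1$ equals the number of indices $i\in\{1,\dots,g-1\}$ with $\ell_{i+1}-\ell_i=2$; equivalently, $g=2\kappa-1$ where $\kappa:=2g-\ell_g$ (so for $\ell_g=2g-(2r+1)$ one has $g=4r+1$ and $\ell_g=6r+1$). For $n\in\mathbb{N}$, $H_n:=\{0,n+1,n+2,\dots\}$; $m\mathbb{N}+H_n:=\{ma+h: a\in\mathbb{N},\,h\in H_n\}$; $\langle A\rangle$ is the additive submonoid of $\mathbb{N}$ generated by $A$. *)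

theory Defs
  imports Main "HOL.Hull"
begin

definition additive_submonoid :: "nat set \<Rightarrow> bool" where
  "additive_submonoid S \<longleftrightarrow> 0 \<in> S \<and> (\<forall>x\<in>S. \<forall>y\<in>S. x + y \<in> S)"

definition generated_submonoid :: "nat set \<Rightarrow> nat set" where
  "generated_submonoid A = additive_submonoid hull A"

definition numerical_semigroup :: "nat set \<Rightarrow> bool" where
  "numerical_semigroup H \<longleftrightarrow> additive_submonoid H \<and> finite (- H)"

definition genus :: "nat set \<Rightarrow> nat" where
  "genus H = card (- H)"

text \<open>The gaps of \<open>H\<close> in increasing order, indexed from 1: \<open>gap H i\<close> is \<open>\<ell>\<^sub>i\<close>
  and is meaningful only for \<open>1 \<le> i \<le> genus H\<close>.\<close>

definition gap :: "nat set \<Rightarrow> nat \<Rightarrow> nat" where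
  "gap H i = sorted_list_of_set (- H) ! (i - 1)"

definition frobenius_number :: "nat set \<Rightarrow> nat" where
  "frobenius_number H = gap H (genus H)"

definition semigroup_multiplicity :: "nat set \<Rightarrow> nat" where
  "semigroup_multiplicity H = (LEAST n. n \<in> H \<and> 0 < n)"

text \<open>The truncated subtraction is harmless here and below, since \<open>gap H\<close> is
  strictly increasing on \<open>{1..genus H}\<close>.\<close>

definition sparse_semigroup :: "nat set \<Rightarrow> bool" where
  "sparse_semigroup H \<longleftrightarrow>
     numerical_semigroup H \<and> (\<forall>i\<in>{2..genus H}. gap H i - gap H (i - 1) \<le> 2)"

definition limit_sparse_semigroup :: "nat set \<Rightarrow> bool" where
  "limit_sparse_semigroup H \<longleftrightarrow>
     sparse_semigroup H \<and>
     card {i \<in> {1..genus H - 1}. gap H (i + 1) - gap H i = 1} =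
     card {i \<in> {1..genus H - 1}. gap H (i + 1) - gap H i = 2}"

text \<open>\<open>ordinary_semigroup n\<close> is \<open>H\<^sub>n = {0, n + 1, n + 2, \<dots>}\<close>.\<close>

definition ordinary_semigroup :: "nat \<Rightarrow> nat set" where
  "ordinary_semigroup n = insert 0 {n + 1..}"

end

(* Call z a gap pair if z - 1 and z are both gaps. If l is a gap pair, then l - a is one for every
   element a <= l; together with sparsity this gives l + 1 = 3 |H \<inter> {0..l}| + s, where the slack s
   counts the gap pairs z <= l with l - z a gap. For m = 2 h + 1, comparing the slack at the last
   gap pair d with the gap pairs below m yields F = d + 2 h, that the elements just below d
   are d - 2, d - 4, ..., d - 2 h, and that d - z is an element for every gap pair z in [m, d].
   If d < 2 m, these are all the elements up to F and the second family results. If d > 2 m and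
   h >= 2, symmetry makes m, m + 2, ..., m + 2 (h - 1) elements, so 3 m - 1 and 3 m are both
   elements, contradicting sparsity. For m = 3 the multiples of 3 already exhaust the count. *)

theory Submission
  imports Defs
begin

section \<open>Sets of naturals without consecutive elements\<close>

text \<open>Each of the \<open>j\<close> blocks \<open>{a + 2 * i, a + 2 * i + 1}\<close> meets
  \<open>W\<close> in at most one point; the induction splits off the top block.\<close>

lemma card_no_two_consecutive_le:
  fixes W :: "nat set"
  assumes "\<And>x. x \<in> W \<Longrightarrow> Suc x \<notin> W" "W \<subseteq> {a..<a + 2 * j}"
  shows "card W \<le> j"
  using assms
proof (induction j arbitrary: W)
  case 0
  then show ?case by simp
next
  case (Suc j)
  let ?x = "a + 2 * j"
  have "W \<inter> {a..<?x} \<subseteq> {a..<?x}" by auto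
  then have IH: "card (W \<inter> {a..<?x}) \<le> j"
    using Suc.prems by (intro Suc.IH) auto
  have "\<exists>y. W \<inter> {?x, Suc ?x} \<subseteq> {y}"
    using Suc.prems(1)[of ?x] by auto
  then obtain y where y: "W \<inter> {?x, Suc ?x} \<subseteq> {y}" ..
  have "W = (W \<inter> {a..<?x}) \<union> (W \<inter> {?x, Suc ?x})"
    using Suc.prems(2) by fastforce
  then have "card W \<le> card (W \<inter> {a..<?x}) + card (W \<inter> {?x, Suc ?x})"
    by (metis card_Un_le)
  moreover have "card (W \<inter> {?x, Suc ?x}) \<le> 1"
    using card_mono[OF _ y] by simp
  ultimately show ?case using IH by simp
qed

text \<open>In an interval of odd length \<open>2 * h - 1\<close> only every second point attains
  the maximum \<open>h\<close>: omitting \<open>a + 2 * j\<close> leaves intervals of lengths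
  \<open>2 * j\<close> and \<open>2 * (h - 1 - j)\<close>, which together hold at most
  \<open>h - 1\<close> points.\<close>

lemma card_no_two_consecutive_eqD:
  fixes W :: "nat set"
  assumes W: "\<And>x. x \<in> W \<Longrightarrow> Suc x \<notin> W" "W \<subseteq> {a..<a + (2 * h - 1)}"
    and "card W = h" "j < h"
  shows "a + 2 * j \<in> W"
proof (rule ccontr)
  assume no: "a + 2 * j \<notin> W"
  let ?L = "W \<inter> {a..<a + 2 * j}" and ?b = "a + 2 * j + 1"
  let ?U = "W \<inter> {?b..<?b + 2 * (h - 1 - j)}"
  have "card ?L \<le> j" "card ?U \<le> h - 1 - j"
    by (rule card_no_two_consecutive_le; use W(1) in auto)+
  moreover have "W = ?L \<union> ?U"
  proof -
    have "x \<in> ?L \<union> ?U" if "x \<in> W" for x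
    proof -
      have "x \<noteq> a + 2 * j" "a \<le> x" "x < a + (2 * h - 1)"
        using that no W(2) by auto
      then show ?thesis using that \<open>j < h\<close> by auto
    qed
    then show ?thesis by blast
  qed
  then have "card W \<le> card ?L + card ?U"
    by (metis card_Un_le)
  ultimately show False using assms(3,4) by simp
qed

section \<open>Gap pairs and the slack identity\<close>

text \<open>Truncated subtraction gives \<open>0 - 1 = 0\<close>, so \<open>0 \<in> H\<close>
  excludes both 0 and 1; the smallest possible gap pair is 2.\<close>

definition gap_pairs :: "nat set \<Rightarrow> nat set" where
  "gap_pairs H = {z. z \<notin> H \<and> z - 1 \<notin> H}"

text \<open>Sparsity in terms of elements, with \<open>F\<close> the Frobenius number: gap
  differences of at most 2 mean no two consecutive elements below \<open>F\<close>. The bound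
  \<open>x < F\<close> matters because everything above \<open>F\<close> is an element.\<close>

locale sparse_gaps =
  fixes H :: "nat set" and F :: nat
  assumes zero: "0 \<in> H"
    and add: "\<And>x y. x \<in> H \<Longrightarrow> y \<in> H \<Longrightarrow> x + y \<in> H"
    and F_gap: "F \<notin> H"
    and above_F: "\<And>x. F < x \<Longrightarrow> x \<in> H"
    and sparse: "\<And>x. x \<in> H \<Longrightarrow> x < F \<Longrightarrow> Suc x \<notin> H"
begin

text \<open>The elements up to \<open>l\<close>, their successors and the gap pairs partition \<open>{0..l}\<close>,
  and \<open>a \<mapsto> l - a\<close> maps elements to gap pairs.\<close>

lemma slack_eq:
  assumes l: "l \<in> gap_pairs H" "l \<le> F"
  shows "l + 1 = 3 * card (H \<inter> {..l})
    + card {z \<in> gap_pairs H. z \<le> l \<and> l - z \<notin> H}"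
proof -
  let ?A = "H \<inter> {..l}" and ?D = "gap_pairs H \<inter> {..l}"
  let ?S = "{z \<in> gap_pairs H. z \<le> l \<and> l - z \<notin> H}"
  have lgap: "l \<notin> H" "l - 1 \<notin> H" using l by (auto simp: gap_pairs_def)
  have part: "{..l} = ?A \<union> Suc ` ?A \<union> ?D"
  proof
    show "{..l} \<subseteq> ?A \<union> Suc ` ?A \<union> ?D"
    proof
      fix x assume "x \<in> {..l}"
      then show "x \<in> ?A \<union> Suc ` ?A \<union> ?D"
        using zero by (cases x) (auto simp: gap_pairs_def)
    qed
    have "x < l" if "x \<in> ?A" for x
      using that lgap by (metis IntD1 IntD2 atMost_iff le_neq_implies_less)
    then show "?A \<union> Suc ` ?A \<union> ?D \<subseteq> {..l}" by fastforce
  qed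
  have disj: "?A \<inter> Suc ` ?A = {}"
  proof -
    have "Suc x \<notin> H" if "x \<in> ?A" for x
      using that sparse[of x] l(2) F_gap by (cases "x = F") auto
    then show ?thesis by auto
  qed
  have disj2: "(?A \<union> Suc ` ?A) \<inter> ?D = {}"
    by (auto simp: gap_pairs_def)
  have "card {..l} = card ?A + card (Suc ` ?A) + card ?D"
    using part disj disj2 by (metis card_Un_disjoint finite_Int finite_Un finite_atMost)
  then have c1: "l + 1 = 2 * card ?A + card ?D"
    by (simp add: card_image)
  have sub: "(\<lambda>a. l - a) ` ?A \<subseteq> ?D"
  proof
    fix z assume "z \<in> (\<lambda>a. l - a) ` ?A"
    then obtain a where a: "a \<in> H" "a \<le> l" "z = l - a" by auto
    have "l - a \<notin> H" using add[of "l - a" a] a lgap by auto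
    moreover have "l - a - 1 \<notin> H"
    proof
      assume "l - a - 1 \<in> H"
      then have "l - a - 1 + a \<in> H" using add a by blast
      \<comment> \<open>The second alternative is the truncated case \<open>a = l\<close>, where 0
        would be a gap.\<close>
      moreover have "l - a - 1 + a = l - 1 \<or> l - a = 0" using a by auto
      ultimately show False using lgap \<open>l - a \<notin> H\<close> zero by auto
    qed
    ultimately show "z \<in> ?D" using a by (auto simp: gap_pairs_def)
  qed
  have D_eq: "?D = (\<lambda>a. l - a) ` ?A \<union> ?S"
  proof
    show "?D \<subseteq> (\<lambda>a. l - a) ` ?A \<union> ?S"
    proof
      fix z assume z: "z \<in> ?D"
      show "z \<in> (\<lambda>a. l - a) ` ?A \<union> ?S"
      proof (cases "l - z \<in> H")
        case True
        with z show ?thesis by (intro UnI1 rev_image_eqI[of "l - z"]) auto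
      qed (use z in auto)
    qed
    show "(\<lambda>a. l - a) ` ?A \<union> ?S \<subseteq> ?D" using sub by auto
  qed
  have "(\<lambda>a. l - a) ` ?A \<inter> ?S = {}" by auto
  moreover have "finite ?S" by (rule finite_subset[of _ "{..l}"]) auto
  ultimately have "card ?D = card ((\<lambda>a. l - a) ` ?A) + card ?S"
    unfolding D_eq by (intro card_Un_disjoint) auto
  moreover have "card ((\<lambda>a. l - a) ` ?A) = card ?A"
    by (rule card_image) (auto simp: inj_on_def)
  ultimately show ?thesis using c1 by simp
qed

section \<open>The last gap pair\<close>

text \<open>Beyond \<open>d\<close> no two gaps are adjacent, and sparsity forbids adjacent
  elements, so membership alternates starting from the gap \<open>d\<close>.\<close>

lemma alternating_above_last_gap_pair:
  assumes d: "d \<in> gap_pairs H" "\<And>z. z \<in> gap_pairs H \<Longrightarrow> z \<le> F \<Longrightarrow> z \<le> d"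
    and "d + j \<le> F"
  shows "d + j \<in> H \<longleftrightarrow> odd j"
  using \<open>d + j \<le> F\<close>
proof (induction j)
  case 0
  then show ?case using d(1) by (simp add: gap_pairs_def)
next
  case (Suc j)
  show ?case
  proof (cases "odd j")
    case True
    then show ?thesis using Suc sparse[of "d + j"] by auto
  next
    case False
    have "d + Suc j \<notin> gap_pairs H" using d(2)[of "d + Suc j"] Suc.prems by auto
    then show ?thesis using Suc False by (auto simp: gap_pairs_def)
  qed
qed

text \<open>At the last gap pair \<open>d\<close> the slack is \<open>t - 1\<close> for \<open>F = d + 2 t\<close>. The gap pairs below the
  multiplicity force it to be at least \<open>h - 1\<close>, whereas \<open>F - m \<notin> H\<close> forces \<open>t \<le> h\<close>.\<close>

lemma last_gap_pair:
  assumes F: "F = 6 * r + 1" and card_H: "card (H \<inter> {..F}) = 2 * r + 1"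
    and m: "m \<in> H" "m = 2 * h + 1" "1 \<le> h" "\<And>x. 0 < x \<Longrightarrow> x < m \<Longrightarrow> x \<notin> H"
  obtains d where "d \<in> gap_pairs H" "F = d + 2 * h" "m \<le> d + 1"
    "\<And>j. d + j \<le> F \<Longrightarrow> d + j \<in> H \<longleftrightarrow> odd j"
    "\<And>i. 1 \<le> i \<Longrightarrow> i \<le> h \<Longrightarrow> d - 2 * i \<in> H"
    "\<And>z. z \<in> gap_pairs H \<Longrightarrow> m \<le> z \<Longrightarrow> z \<le> d \<Longrightarrow> d - z \<in> H"
proof -
  \<comment> \<open>Otherwise the slack equation at \<open>F\<close> would read
    \<open>6 * r + 2 = 6 * r + 3 + s\<close>.\<close>
  have "F \<notin> gap_pairs H"
    using slack_eq[of F] card_H F by auto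
  then have F1: "F - 1 \<in> H" using F_gap by (auto simp: gap_pairs_def)
  \<comment> \<open>If \<open>m > F\<close>, then 0 is the only element up to \<open>F\<close>, so
    \<open>r = 0\<close> and \<open>F = 1\<close>, and 2 is a positive element below
    \<open>m\<close>.\<close>
  have m_le: "m \<le> F"
  proof (rule ccontr)
    assume "\<not> m \<le> F"
    then have "x \<in> H \<inter> {..F} \<Longrightarrow> x = 0" for x using m(4)[of x] by fastforce
    then have "H \<inter> {..F} \<subseteq> {0}" by blast
    then have "card (H \<inter> {..F}) \<le> 1" using card_mono[of "{0::nat}"] by fastforce
    then have "F = 1" using card_H F by simp
    then show False using \<open>\<not> m \<le> F\<close> m above_F[of 2] m(4)[of 2] by auto
  qed
  define d where "d = Max (gap_pairs H \<inter> {..F})"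
  have base: "m - 1 \<in> gap_pairs H \<inter> {..F}"
    using m(2,3) m(4)[of "m - 1"] m(4)[of "m - 1 - 1"] m_le by (auto simp: gap_pairs_def)
  then have "d \<in> gap_pairs H \<inter> {..F}" unfolding d_def by (intro Max_in) auto
  then have dD: "d \<in> gap_pairs H" "d \<le> F" by auto
  have dmax: "z \<le> d" if "z \<in> gap_pairs H" "z \<le> F" for z
    unfolding d_def using that by (intro Max_ge) auto
  have md: "m \<le> d + 1" using dmax[of "m - 1"] base by auto
  have alt: "d + j \<in> H \<longleftrightarrow> odd j" if "d + j \<le> F" for j
    using alternating_above_last_gap_pair[OF dD(1) dmax that] .
  have "even (F - d)" using alt[of "F - d"] dD(2) F_gap by simp
  then obtain t where "F - d = 2 * t" by (elim evenE)
  then have t: "F = d + 2 * t" using dD(2) by simp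
  have cardt: "card (H \<inter> {..F}) = card (H \<inter> {..d}) + t"
  proof -
    have "H \<inter> {..F} = (H \<inter> {..d}) \<union> (\<lambda>i. d + 2 * i + 1) ` {..<t}"
    proof -
      have "x \<in> H \<longleftrightarrow> x \<in> (\<lambda>i. d + 2 * i + 1) ` {..<t}" if "d < x" "x \<le> F" for x
      proof -
        have "x \<in> H \<longleftrightarrow> odd (x - d)" using alt[of "x - d"] that by simp
        also have "\<dots> \<longleftrightarrow> (\<exists>i<t. x = d + 2 * i + 1)"
        proof
          assume "odd (x - d)"
          then obtain k where "x - d = 2 * k + 1" by (elim oddE)
          then have "x = d + 2 * k + 1" "k < t" using that t by auto
          then show "\<exists>i<t. x = d + 2 * i + 1" by blast
        qed auto
        also have "\<dots> \<longleftrightarrow> x \<in> (\<lambda>i. d + 2 * i + 1) ` {..<t}" by auto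
        finally show ?thesis .
      qed
      then have "x \<in> H \<inter> {..F} \<longleftrightarrow> x \<in> (H \<inter> {..d}) \<union> (\<lambda>i. d + 2 * i + 1) ` {..<t}" for x
        using t by (cases "x \<le> d") auto
      then show ?thesis by blast
    qed
    moreover have "card ((\<lambda>i. d + 2 * i + 1) ` {..<t}) = t"
      by (subst card_image) (auto simp: inj_on_def)
    moreover have "(H \<inter> {..d}) \<inter> (\<lambda>i. d + 2 * i + 1) ` {..<t} = {}" by auto
    ultimately show ?thesis by (simp add: card_Un_disjoint)
  qed
  let ?S = "{z \<in> gap_pairs H. z \<le> d \<and> d - z \<notin> H}"
  \<comment> \<open>All of \<open>2, ..., m - 1\<close> are gap pairs, and
    \<open>m \<le> d + 1\<close> puts them below or at \<open>d\<close>.\<close>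
  let ?Z = "{z \<in> {2..<m}. d - z \<notin> H}"
  \<comment> \<open>With \<open>2 * r + 1 - t\<close> elements up to
    \<open>d = 6 * r + 1 - 2 * t\<close>, the slack equation leaves \<open>t - 1\<close>.\<close>
  have slack: "card ?S + 1 = t"
    using slack_eq[OF dD] cardt card_H F t by simp
  have t_le: "t \<le> h"
  proof (rule ccontr)
    assume "\<not> t \<le> h"
    \<comment> \<open>This number is \<open>F - m\<close>; its distance \<open>2 * t - m\<close>
      from \<open>d\<close> is odd, and positive since \<open>t > h\<close>.\<close>
    then have "d + (2 * t - m) \<in> H" using alt[of "2 * t - m"] t m(2) by auto
    then have "d + (2 * t - m) + m \<in> H" using add m(1) by blast
    then show False using F_gap t m(2) \<open>\<not> t \<le> h\<close> by (simp add: add.commute)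
  qed
  have ZS: "?Z \<subseteq> ?S"
  proof
    fix z assume z: "z \<in> ?Z"
    then have "0 < z" "z < m" "0 < z - 1" "z - 1 < m" by auto
    then have "z \<notin> H" "z - 1 \<notin> H" using m(4) by blast+
    then show "z \<in> ?S" using z md by (simp add: gap_pairs_def)
  qed
  have finS: "finite ?S" by (rule finite_subset[of _ "{..d}"]) auto
  \<comment> \<open>The reflection \<open>z \<mapsto> d - z\<close> carries \<open>{2..<m}\<close>
    onto the interval of length \<open>2 * h - 1\<close> starting at \<open>a\<close>.\<close>
  define a where "a = d + 1 - m"
  let ?W = "H \<inter> {a..<a + (2 * h - 1)}"
  have ind: "x \<in> ?W \<Longrightarrow> Suc x \<notin> ?W" for x
  proof
    assume x: "x \<in> ?W" "Suc x \<in> ?W"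
    then have "Suc x < d" using m(2,3) md by (auto simp: a_def)
    then show False using sparse[of x] x dD(2) by auto
  qed
  have W_le: "card ?W \<le> h"
    by (rule card_no_two_consecutive_le[OF ind, of a]) auto
  have "card ?W + card ?Z = 2 * h - 1"
  proof -
    have b: "bij_betw (\<lambda>z. d - z) ?Z ({a..<a + (2 * h - 1)} - H)"
      using md m(2,3)
      by (intro bij_betw_byWitness[where f' = "\<lambda>z. d - z"]) (auto simp: a_def)
    have "card ({a..<a + (2 * h - 1)}) = card ?W + card ({a..<a + (2 * h - 1)} - H)"
      using card_Int_Diff[of "{a..<a + (2 * h - 1)}" H] by (simp add: Int_commute)
    then show ?thesis using bij_betw_same_card[OF b] by simp
  qed
  moreover have "card ?Z \<le> card ?S" by (rule card_mono[OF finS ZS])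
  \<comment> \<open>The chain \<open>h - 1 \<le> card ?Z \<le> card ?S = t - 1 \<le> h - 1\<close>
    collapses to equalities: \<open>?W\<close> is maximal, and no gap pair from \<open>m\<close> on
    contributes to the slack.\<close>
  ultimately have th: "t = h" and W_eq: "card ?W = h" and "card ?Z = card ?S"
    using W_le slack t_le m(3) by linarith+
  then have ZS_eq: "?Z = ?S" using card_subset_eq[OF finS ZS] by simp
  show ?thesis
  proof (rule that)
    show "d \<in> gap_pairs H" "m \<le> d + 1" by fact+
    show "F = d + 2 * h" using t th by simp
    show "d + j \<in> H \<longleftrightarrow> odd j" if "d + j \<le> F" for j by (fact alt[OF that])
    show "d - 2 * i \<in> H" if "1 \<le> i" "i \<le> h" for i
    proof -
      have "a + 2 * (h - i) \<in> ?W"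
        by (rule card_no_two_consecutive_eqD[OF ind _ W_eq]) (use that in auto)
      moreover have "a + 2 * (h - i) = d - 2 * i" using that md m(2) by (auto simp: a_def)
      ultimately show ?thesis by auto
    qed
    show "d - z \<in> H" if "z \<in> gap_pairs H" "m \<le> z" "z \<le> d" for z
    proof (rule ccontr)
      assume "d - z \<notin> H"
      then have "z \<in> ?Z" unfolding ZS_eq using that by auto
      then show False using that by auto
    qed
  qed
qed

section \<open>Elements up to the Frobenius number for odd multiplicity\<close>

text \<open>Once \<open>d < 2 * m\<close> is known, the positive elements up to \<open>F\<close> are
  \<open>h\<close> alternate numbers just below \<open>d\<close> and \<open>h\<close> just above it;
  the count \<open>2 * h + 1 = 2 * r + 1\<close> then fixes \<open>h\<close>.\<close>

lemma elements_of_odd_multiplicity: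
  assumes F: "F = 6 * r + 1" and card_H: "card (H \<inter> {..F}) = 2 * r + 1"
    and m: "m \<in> H" "m = 2 * h + 1" "2 \<le> h" "\<And>x. 0 < x \<Longrightarrow> x < m \<Longrightarrow> x \<notin> H"
  shows "h = r \<and> H \<inter> {0<..F} =
    (\<lambda>i. 2 * r + 1 + 2 * i) ` {..<r} \<union> (\<lambda>i. 4 * r + 2 + 2 * i) ` {..<r}"
proof -
  have "1 \<le> h" using m(3) by simp
  from last_gap_pair[OF F card_H m(1,2) this m(4)]
  obtain d where d: "d \<in> gap_pairs H" "F = d + 2 * h" "m \<le> d + 1"
    and alt: "\<And>j. d + j \<le> F \<Longrightarrow> d + j \<in> H \<longleftrightarrow> odd j"
    and below: "\<And>i. 1 \<le> i \<Longrightarrow> i \<le> h \<Longrightarrow> d - 2 * i \<in> H"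
    and refl: "\<And>z. z \<in> gap_pairs H \<Longrightarrow> m \<le> z \<Longrightarrow> z \<le> d \<Longrightarrow> d - z \<in> H"
    by blast
  have "d \<noteq> 2 * m" using d(1) add[OF m(1) m(1)] by (auto simp: gap_pairs_def mult_2)
  have d_lt: "d < 2 * m"
  proof (rule ccontr)
    assume "\<not> d < 2 * m"
    then have dm: "2 * m < d" using \<open>d \<noteq> 2 * m\<close> by simp
    \<comment> \<open>Since \<open>F = d + m - 1\<close>, this number is \<open>F\<close> minus the
      element \<open>d - 2 * i\<close>.\<close>
    have even_gap: "m - 1 + 2 * i \<notin> H" if "1 \<le> i" "i \<le> h" for i
    proof
      assume "m - 1 + 2 * i \<in> H"
      then have "m - 1 + 2 * i + (d - 2 * i) \<in> H" using add below[OF that] by blast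
      moreover have "m - 1 + 2 * i + (d - 2 * i) = F" using that dm d(2) m(2) by simp
      ultimately show False using F_gap by simp
    qed
    \<comment> \<open>A gap here would lie between two even-indexed gaps, giving two consecutive gap
      pairs whose reflections in \<open>d\<close> are consecutive elements.\<close>
    have odd_elem: "m + 2 * i \<in> H" if "i < h" for i
    proof (rule ccontr)
      assume no: "m + 2 * i \<notin> H"
      then have "1 \<le> i" using m(1) by (cases i) auto
      have "m + 2 * i - 1 \<notin> H" using even_gap[of i] \<open>1 \<le> i\<close> that m(2) by simp
      moreover have "m + 2 * i + 1 \<notin> H" using even_gap[of "i + 1"] that m(2) by simp
      ultimately have "m + 2 * i \<in> gap_pairs H" "m + 2 * i + 1 \<in> gap_pairs H"
        using no by (auto simp: gap_pairs_def)
      then have "d - (m + 2 * i) \<in> H" "d - (m + 2 * i + 1) \<in> H"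
        using that dm m(2) by (auto intro!: refl)
      moreover have "Suc (d - (m + 2 * i + 1)) = d - (m + 2 * i)"
        using that dm m(2) by simp
      moreover have "d - (m + 2 * i + 1) < F" using d(2) m(3) by simp
      ultimately show False using sparse by metis
    qed
    \<comment> \<open>Both indices 1 and \<open>h - 1\<close> are below \<open>h\<close> because
      \<open>h \<ge> 2\<close>; \<open>d > 2 * m\<close> puts the resulting \<open>3 * m - 1\<close>
      below \<open>F\<close>.\<close>
    have "(m + 2 * (h - 1)) + (m + 2 * 1) \<in> H"
      using m(3) by (intro add odd_elem) auto
    moreover have "(m + 2 * (h - 1)) + (m + 2 * 1) = 3 * m - 1" using m(2,3) by simp
    ultimately have "3 * m - 1 \<in> H" by metis
    moreover have "m + (m + m) \<in> H" using add m(1) by blast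
    then have "Suc (3 * m - 1) \<in> H" using m(2) by (simp add: numeral_3_eq_3)
    ultimately show False using sparse[of "3 * m - 1"] d(2) dm m(2) by simp
  qed
  have d_gap: "d \<notin> H" using d(1) by (simp add: gap_pairs_def)
  have H_eq: "H \<inter> {0<..F} = (\<lambda>i. d + 1 - m + 2 * i) ` {..<h} \<union> (\<lambda>i. d + 1 + 2 * i) ` {..<h}"
    (is "_ = ?L \<union> ?U")
  proof (intro equalityI subsetI)
    fix x assume x: "x \<in> H \<inter> {0<..F}"
    then have mx: "m \<le> x" using m(4)[of x] by force
    have dm: "x \<noteq> d - m \<or> d \<le> m"
      using x add[of "d - m" m] m(1) d_gap by auto
    show "x \<in> ?L \<union> ?U"
    proof (cases "x \<le> d")
      case True
      then have xd: "x < d" using x d_gap by (cases "x = d") auto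
      define j where "j = d - x"
      \<comment> \<open>The bounds \<open>m \<le> x\<close> and \<open>d < 2 * m\<close> keep
        \<open>j\<close> at most \<open>m - 1 = 2 * h\<close>.\<close>
      have xj: "x = d - j" "1 \<le> j" "j \<le> 2 * h" "j < d"
        using xd mx dm d_lt m(2) x by (auto simp: j_def)
      have "even j"
      proof (rule ccontr)
        assume "odd j"
        then obtain k where k: "j = 2 * k + 1" by (elim oddE)
        then have "d - 2 * (k + 1) \<in> H" using below[of "k + 1"] xj by simp
        moreover have "Suc (d - 2 * (k + 1)) = x" using xj k by simp
        ultimately show False using sparse[of "d - 2 * (k + 1)"] x d(2) xj m(3) by auto
      qed
      then obtain k where k: "j = 2 * k" by (elim evenE)
      have "x = d + 1 - m + 2 * (h - k)" "h - k < h" using xj k m(2) d(3) by auto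
      then show ?thesis by blast
    next
      case False
      then have "odd (x - d)" using alt[of "x - d"] x by auto
      then obtain k where "x - d = 2 * k + 1" by (elim oddE)
      then have "x = d + 1 + 2 * k" "k < h" using False x d(2) by auto
      then show ?thesis by blast
    qed
  next
    fix x assume "x \<in> ?L \<union> ?U"
    then show "x \<in> H \<inter> {0<..F}"
    proof
      assume "x \<in> ?L"
      then obtain i where i: "x = d + 1 - m + 2 * i" "i < h" by auto
      then have xe: "x = d - 2 * (h - i)" using m(2) d(3) by auto
      then have "x \<in> H" using below[of "h - i"] i by auto
      \<comment> \<open>\<open>x = 0\<close> would force \<open>d = 2 * h\<close>, making
        \<open>d - 2 * (h - 1) = 2\<close> an element below \<open>m\<close>.\<close>
      moreover have "x \<noteq> 0"
      proof
        assume "x = 0"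
        then have "d + 1 = m" using i d(3) by auto
        then have "d - 2 * (h - 1) \<in> H" "d - 2 * (h - 1) = 2"
          using below[of "h - 1"] m(2,3) by auto
        then show False using m(4)[of 2] m(2,3) by auto
      qed
      ultimately show ?thesis using xe d(2) by auto
    next
      assume "x \<in> ?U"
      then obtain i where "x = d + (1 + 2 * i)" "i < h" by auto
      then show ?thesis using alt[of "1 + 2 * i"] d(2) by auto
    qed
  qed
  have "card ?L = h" "card ?U = h"
    using d(3) by (auto simp: inj_on_def intro!: card_image[THEN trans])
  moreover have "?L \<inter> ?U = {}" using m(2) d(3) by auto
  ultimately have "card (H \<inter> {0<..F}) = h + h"
    unfolding H_eq by (subst card_Un_disjoint) auto
  moreover have "H \<inter> {..F} = insert 0 (H \<inter> {0<..F})" using zero by auto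
  ultimately have hr: "h = r" using card_H by simp
  \<comment> \<open>From \<open>h = r\<close> and \<open>F = 6 * r + 1\<close> it follows that
    \<open>d = 4 * r + 1\<close>.\<close>
  have e: "d + 1 - m = 2 * r + 1" "d + 1 = 4 * r + 2" using hr F d(2) m(2) by auto
  show ?thesis using H_eq[unfolded e(1), unfolded e(2)] hr by simp
qed

text \<open>This settles \<open>h = 1\<close>, where \<open>m + 2\<close> is not supplied by the
  argument for \<open>h \<ge> 2\<close>: there are already \<open>2 * r + 1\<close> multiples of 3
  up to \<open>6 * r + 1\<close>.\<close>

lemma elements_of_multiplicity_three:
  assumes F: "F = 6 * r + 1" and card_H: "card (H \<inter> {..F}) = 2 * r + 1" and m: "3 \<in> H"
  shows "H \<inter> {..F} = (\<lambda>a. 3 * a) ` {..2 * r}"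
proof -
  have mem: "3 * a \<in> H" for a
  proof (induction a)
    case (Suc a)
    then show ?case using add[OF m] by simp
  qed (simp add: zero)
  have "(\<lambda>a. 3 * a) ` {..2 * r} \<subseteq> H \<inter> {..F}" using mem F by auto
  moreover have "card ((\<lambda>a::nat. 3 * a) ` {..2 * r}) = 2 * r + 1"
    by (subst card_image) (auto simp: inj_on_def)
  ultimately show ?thesis using card_subset_eq[of "H \<inter> {..F}"] card_H by auto
qed

end

section \<open>From the list of gaps to the locale\<close>

lemma frobenius_number_facts:
  assumes "finite (- H)" "H \<noteq> UNIV"
  shows "frobenius_number H \<notin> H" "\<And>x. frobenius_number H < x \<Longrightarrow> x \<in> H"
proof -
  let ?L = "sorted_list_of_set (- H)"
  have ne: "?L \<noteq> []" using assms by auto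
  have len: "length ?L = genus H" using assms by (simp add: genus_def)
  have F: "frobenius_number H = last ?L"
    using ne len by (simp add: frobenius_number_def gap_def last_conv_nth)
  then show "frobenius_number H \<notin> H"
    using last_in_set[OF ne] assms(1) by simp
  show "x \<in> H" if "frobenius_number H < x" for x
  proof (rule ccontr)
    assume "x \<notin> H"
    then have "x \<in> set ?L" using assms(1) by simp
    then obtain i where i: "i < length ?L" "?L ! i = x" by (auto simp: in_set_conv_nth)
    then have "?L ! i \<le> ?L ! (length ?L - 1)" by (intro sorted_nth_mono) auto
    then show False using i F that ne by (simp add: last_conv_nth)
  qed
qed

text \<open>If \<open>x\<close> and \<open>x + 1\<close> were elements below the Frobenius number,
  the last gap before \<open>x\<close> and the next gap would differ by at least 3.\<close>

lemma sparse_semigroup_gaps: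
  assumes "sparse_semigroup H" "H \<noteq> UNIV"
  shows "sparse_gaps H (frobenius_number H)"
proof
  have H: "additive_submonoid H" and fin: "finite (- H)"
    using assms(1) by (auto simp: sparse_semigroup_def numerical_semigroup_def)
  show zero: "0 \<in> H" and add: "\<And>x y. x \<in> H \<Longrightarrow> y \<in> H \<Longrightarrow> x + y \<in> H"
    using H by (auto simp: additive_submonoid_def)
  show F_gap: "frobenius_number H \<notin> H"
    and "\<And>x. frobenius_number H < x \<Longrightarrow> x \<in> H"
    using frobenius_number_facts[OF fin assms(2)] by auto
  fix x assume x: "x \<in> H" "x < frobenius_number H"
  show "Suc x \<notin> H"
  proof
    assume Sx: "Suc x \<in> H"
    let ?L = "sorted_list_of_set (- H)"
    have len: "length ?L = genus H" using fin by (simp add: genus_def)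
    have one: "1 \<notin> H"
    proof
      assume "1 \<in> H"
      then have "n \<in> H" for n by (induction n) (use zero add[of 1] in auto)
      then show False using assms(2) by auto
    qed
    then have "0 < x" using Sx by (cases x) auto
    with x one have "1 < x" by (cases "x = 1") auto
    define u where "u = Max (- H \<inter> {..<x})"
    have "u \<in> - H \<inter> {..<x}" unfolding u_def
      using one \<open>1 < x\<close> by (intro Max_in) auto
    then have u: "u \<notin> H" "u < x" by auto
    have umax: "z \<le> u" if "z \<notin> H" "z < x" for z
      unfolding u_def using that by (intro Max_ge) auto
    have "u \<in> set ?L" using u fin by simp
    then obtain i where i: "i < genus H" "?L ! i = u" unfolding in_set_conv_nth len by blast
    have "i \<noteq> genus H - 1"
      using i x u by (auto simp: frobenius_number_def gap_def)
    then have i1: "Suc i < genus H" using i by simp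
    define v where "v = ?L ! Suc i"
    have "v \<in> set ?L" unfolding v_def using i1 len by (metis nth_mem)
    then have v: "v \<notin> H" using fin by simp
    have "u < v" unfolding v_def i(2)[symmetric]
      by (rule sorted_wrt_nth_less[OF strict_sorted_list_of_set]) (use i1 len in auto)
    then have "\<not> v < x" using umax[of v] v by auto
    then have "Suc (Suc x) \<le> v"
      using v x Sx by (cases "v = x"; cases "v = Suc x") auto
    \<comment> \<open>The list counts from 0 and \<open>gap\<close> from 1, so \<open>u\<close> and
      \<open>v\<close> are the gaps with indices \<open>i + 1\<close> and
      \<open>i + 2\<close>.\<close>
    then have "2 < gap H (Suc (Suc i)) - gap H (Suc (Suc i) - 1)"
      using u i by (simp add: gap_def v_def)
    moreover have "Suc (Suc i) \<in> {2..genus H}" using i1 by auto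
    ultimately show False using assms(1) unfolding sparse_semigroup_def by (meson not_le)
  qed
qed

section \<open>Identification of the two families\<close>

theorem theorem3p9:
  fixes H :: "nat set" and g r :: nat
  assumes "limit_sparse_semigroup H"
    and "genus H = g" and "g \<ge> 1"
    and "int (frobenius_number H) = 2 * int g - (2 * int r + 1)"
    and "frobenius_number H = 6 * r + 1"
    and "odd (semigroup_multiplicity H)"
  shows "H = {3 * a + h | a h. h \<in> ordinary_semigroup (6 * r + 1)} \<or>
         (r > 1 \<and>
          H = generated_submonoid {2 * j + 1 | j. r \<le> j \<and> j \<le> 2 * r - 1}
              \<union> ordinary_semigroup (6 * r + 1))"
proof -
  define F where "F = 6 * r + 1"
  have "H \<noteq> UNIV" using assms(2,3) by (auto simp: genus_def)
  moreover have sp: "sparse_semigroup H" using assms(1) by (simp add: limit_sparse_semigroup_def)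
  ultimately interpret sparse_gaps H F
    using sparse_semigroup_gaps[of H] assms(5) by (simp add: F_def)
  have fin: "finite (- H)"
    using sp by (simp add: sparse_semigroup_def numerical_semigroup_def)
  \<comment> \<open>The two expressions for the Frobenius number give \<open>g = 4 * r + 1\<close>;
    removing the gaps from \<open>{..F}\<close> leaves \<open>6 * r + 2 - g\<close>
    elements.\<close>
  have card_H: "card (H \<inter> {..F}) = 2 * r + 1"
  proof -
    have "{..F} = (H \<inter> {..F}) \<union> - H" using above_F by (auto intro: leI)
    moreover have "card ((H \<inter> {..F}) \<union> - H) = card (H \<inter> {..F}) + card (- H)"
      using fin by (intro card_Un_disjoint) auto
    ultimately have "card {..F} = card (H \<inter> {..F}) + card (- H)" by argo
    then show ?thesis using assms(2,4,5) by (simp add: genus_def F_def)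
  qed
  define m where "m = semigroup_multiplicity H"
  have "Suc F \<in> H \<and> 0 < Suc F" using above_F by simp
  then have m: "m \<in> H" "0 < m"
    unfolding m_def semigroup_multiplicity_def by (metis (mono_tags, lifting) LeastI)+
  have m_least: "x \<notin> H" if "0 < x" "x < m" for x
    using that not_less_Least unfolding m_def semigroup_multiplicity_def by blast
  obtain h where h: "m = 2 * h + 1" using assms(6) by (auto simp: m_def elim: oddE)
  have "h \<noteq> 0"
  proof
    assume "h = 0"
    then have "1 \<in> H" using m h by simp
    then have "n \<in> H" for n by (induction n) (use zero add[of 1] in auto)
    then show False using F_gap by simp
  qed
  then consider "h = 1" | "2 \<le> h" by linarith
  then show ?thesis
  proof cases
    case 1
    then have H3: "H \<inter> {..F} = (\<lambda>a. 3 * a) ` {..2 * r}"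
      using elements_of_multiplicity_three[OF F_def card_H] m h by simp
    have "3 * a \<in> H" for a
    proof (cases "3 * a \<le> F")
      case True
      then have "a \<le> 2 * r" by (simp add: F_def)
      then show ?thesis using H3 by blast
    qed (use above_F in auto)
    moreover have ord: "k \<in> H" if "k \<in> ordinary_semigroup F" for k
      using that zero above_F by (auto simp: ordinary_semigroup_def)
    ultimately have "3 * a + k \<in> H" if "k \<in> ordinary_semigroup F" for a k
      using that by (intro add)
    moreover have "\<exists>a k. x = 3 * a + k \<and> k \<in> ordinary_semigroup F" if "x \<in> H" for x
    proof (cases "x \<le> F")
      case True
      then have "x \<in> (\<lambda>a. 3 * a) ` {..2 * r}" using that H3 by auto
      then obtain a where "x = 3 * a + 0" by auto
      moreover have "0 \<in> ordinary_semigroup F" by (simp add: ordinary_semigroup_def)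
      ultimately show ?thesis by blast
    next
      case False
      then have "x = 3 * 0 + x" "x \<in> ordinary_semigroup F"
        by (auto simp: ordinary_semigroup_def)
      then show ?thesis by metis
    qed
    ultimately have "x \<in> H \<longleftrightarrow> (\<exists>a k. x = 3 * a + k \<and> k \<in> ordinary_semigroup F)" for x
      by metis
    then have "H = {3 * a + k | a k. k \<in> ordinary_semigroup F}" by (intro set_eqI) simp
    then show ?thesis by (simp add: F_def)
  next
    case 2
    let ?G = "{2 * j + 1 | j. r \<le> j \<and> j \<le> 2 * r - 1}"
    from elements_of_odd_multiplicity[OF F_def card_H m(1) h 2 m_least]
    have "h = r" and H_eq: "H \<inter> {0<..F} =
      (\<lambda>i. 2 * r + 1 + 2 * i) ` {..<r} \<union> (\<lambda>i. 4 * r + 2 + 2 * i) ` {..<r}" by auto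
    then have r: "r > 1" using 2 by simp
    have G_sub: "?G \<subseteq> H"
    proof
      fix x assume "x \<in> ?G"
      then obtain j where j: "x = 2 * j + 1" "r \<le> j" "j \<le> 2 * r - 1" by auto
      then have "x = 2 * r + 1 + 2 * (j - r)" "j - r < r" using r by auto
      then show "x \<in> H" using H_eq by blast
    qed
    have "additive_submonoid H" using zero add by (auto simp: additive_submonoid_def)
    with G_sub have "generated_submonoid ?G \<subseteq> H"
      unfolding generated_submonoid_def by (rule hull_minimal)
    moreover have "ordinary_semigroup F \<subseteq> H"
      using zero above_F by (auto simp: ordinary_semigroup_def)
    moreover have "x \<in> generated_submonoid ?G \<union> ordinary_semigroup F" if "x \<in> H" for x
    proof (cases "x \<in> H \<inter> {0<..F}")
      case False
      then show ?thesis using that by (auto simp: ordinary_semigroup_def)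
    next
      case True
      have gen: "2 * r + 1 + 2 * i \<in> generated_submonoid ?G" if "i < r" for i
      proof -
        have "2 * r + 1 + 2 * i \<in> ?G" using that by (intro CollectI exI[of _ "r + i"]) auto
        then show ?thesis unfolding generated_submonoid_def by (rule hull_inc)
      qed
      have sum: "y + z \<in> generated_submonoid ?G"
        if "y \<in> generated_submonoid ?G" "z \<in> generated_submonoid ?G" for y z
        using that unfolding generated_submonoid_def hull_def additive_submonoid_def by blast
      from True H_eq consider i where "i < r" "x = 2 * r + 1 + 2 * i"
        | i where "i < r" "x = 4 * r + 2 + 2 * i" by blast
      then show ?thesis
      proof cases
        case 1
        then show ?thesis using gen by blast
      next
        case 2
        \<comment> \<open>The upper block is the lower one shifted by the generator
          \<open>2 * r + 1\<close>.\<close>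
        then have "x = (2 * r + 1 + 2 * 0) + (2 * r + 1 + 2 * i)" by simp
        then show ?thesis using sum[OF gen gen, of 0 i] 2 by auto
      qed
    qed
    ultimately have "H = generated_submonoid ?G \<union> ordinary_semigroup F" by blast
    then show ?thesis using r by (simp add: F_def)
  qed
qed

end
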